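(* For $\theta\in\mathbb{R}^3$ let $X\sim U(\mathcal{B}_\theta(1))$ and $Y\sim U(\mathcal{B}_\theta(1))$ be independent, and consider the estimation of the density $\frac{3}{4\pi}\,\mathbb{I}_{\mathcal{B}_\theta(1)}(y)$ of $Y$ under the $L_1$ loss $L(\theta,\hat q)=\int_{\mathbb{R}^3}\big|\frac{3}{4\pi}\mathbb{I}_{\mathcal{B}_\theta(1)}(y)-\hat q(y)\big|\,dy$. Then, among the predictive densities $\hat q_c(y;X)=\frac{3}{4c^3\pi}\,\mathbb{I}_{\mathcal{B}_X(c)}(y)$, $c>0$, the plug-in choice $\hat q_1$ is optimal.
   Context: $\mathcal{B}_\mu(m)=\{t\in\mathbb{R}^3:\|t-\mu\|\le m\}$ is the ball of radius $m$ centered at $\mu$, and $U(\mathcal{B}_\mu(m))$ is the uniform distribution on it. The risk is $R(\theta,\hat q_c)=\mathbb{E}_\theta\,L(\theta,\hat q_c(\cdot;X))$, which for each $c$ does not depend on $\theta$; optimality of $\hat q_1$ means $R(\theta,\hat q_1)\le R(\theta,\hat q_c)$ for all $c>0$ (and all $\theta$). *)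

theory Defs
  imports "HOL-Probability.Probability"
begin

definition uniform_ball :: "real ^ 3 \<Rightarrow> real \<Rightarrow> (real ^ 3) measure" where
  "uniform_ball \<mu> m = uniform_measure lborel (cball \<mu> m)"

definition has_law :: "'a measure \<Rightarrow> ('a \<Rightarrow> real ^ 3) \<Rightarrow> (real ^ 3) measure \<Rightarrow> bool" where
  "has_law M X \<nu> \<longleftrightarrow> X \<in> borel_measurable M \<and> distr M borel X = \<nu>"

definition true_density :: "real ^ 3 \<Rightarrow> real ^ 3 \<Rightarrow> real" where
  "true_density \<theta> y = 3 / (4 * pi) * indicator (cball \<theta> 1) y"

definition pred_density :: "real \<Rightarrow> real ^ 3 \<Rightarrow> real ^ 3 \<Rightarrow> real" where
  "pred_density c x y = 3 / (4 * c ^ 3 * pi) * indicator (cball x c) y"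

definition L1_loss :: "real ^ 3 \<Rightarrow> (real ^ 3 \<Rightarrow> real) \<Rightarrow> real" where
  "L1_loss \<theta> q = (\<integral>y. \<bar>true_density \<theta> y - q y\<bar> \<partial>lborel)"

(* M carries the distribution of the observation X under the parameter \<theta>;
   q maps an observed value to the predictive density it yields. *)
definition risk ::
    "'a measure \<Rightarrow> ('a \<Rightarrow> real ^ 3) \<Rightarrow> real ^ 3 \<Rightarrow> (real ^ 3 \<Rightarrow> real ^ 3 \<Rightarrow> real) \<Rightarrow> real" where
  "risk M X \<theta> q = (\<integral>\<omega>. L1_loss \<theta> (q (X \<omega>)) \<partial>M)"

end

theory Submission
  imports Defs
begin

text \<open>
  The loss equals \<open>2 - 2\<close> times the overlap of the two densities, and the overlap is
  \<open>min 1 (1/c\<^sup>3)\<close> times the normalised volume of \<open>cball \<theta> 1 \<inter> cball X c\<close>. Averaging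
  over \<open>X\<close>, one has to maximise \<open>min 1 (1/c\<^sup>3) F(c)\<close>, where \<open>F(c)\<close> is the probability that
  two independent uniform points of the unit ball are at distance at most \<open>c\<close>. For \<open>c \<le> 1\<close>
  this is monotonicity of \<open>F\<close>. For \<open>c \<ge> 1\<close>, \<open>F(c)/c\<^sup>3\<close> is up to a constant the average of
  \<open>A(z) = vol (S \<inter> (S - z))\<close> over the ball of radius \<open>c\<close>, where \<open>S\<close> is the unit ball;
  convexity of \<open>S\<close> makes \<open>A\<close> decrease along rays, so this average decreases in \<open>c\<close>.
\<close>

lemma cball_in_borel [measurable]:
  "cball (x::'a::euclidean_space) r \<in> sets borel"
  by (simp add: borel_closed)

lemma nn_integral_lborel_translate:
  fixes f :: "'a::euclidean_space \<Rightarrow> ennreal"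
  assumes [measurable]: "f \<in> borel_measurable borel"
  shows "(\<integral>\<^sup>+x. f (a + x) \<partial>lborel) = (\<integral>\<^sup>+x. f x \<partial>lborel)"
  by (subst (2) lborel_distr_plus[of a, symmetric]) (simp add: nn_integral_distr)

lemma nn_integral_lborel_scaleR:
  fixes f :: "'a::euclidean_space \<Rightarrow> ennreal"
  assumes [measurable]: "f \<in> borel_measurable borel" and c: "c > 0"
  shows "(\<integral>\<^sup>+x. f x \<partial>lborel) = ennreal (c ^ DIM('a)) * (\<integral>\<^sup>+x. f (c *\<^sub>R x) \<partial>lborel)"
  using c
  by (subst lborel_affine[of c 0])
     (simp_all add: nn_integral_density nn_integral_distr nn_integral_cmult ennreal_power)

text \<open>If \<open>x\<close> and \<open>x + c *\<^sub>R z\<close> lie in the convex set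
  \<open>S\<close>, so does the segment between them, and this contains a copy of the shorter
  segment spanned by \<open>z\<close>. Hence one fixed translation carries
  \<open>S \<inter> (S - c z)\<close> into \<open>S \<inter> (S - z)\<close>, and Lebesgue measure
  does not see the translation.\<close>

lemma nn_integral_convex_overlap_antimono:
  fixes S :: "'a::euclidean_space set"
  assumes S: "convex S" and [measurable]: "S \<in> sets borel" and c: "1 \<le> c"
  shows "(\<integral>\<^sup>+x. indicator S x * indicator S (x + c *\<^sub>R z) \<partial>lborel)
    \<le> (\<integral>\<^sup>+x. indicator S x * indicator S (x + z) \<partial>lborel :: ennreal)"
proof -
  \<comment> \<open>This offset centres the short segment in the long one: an excess of
    \<open>c - 1\<close> times \<open>z\<close> is split equally between the two ends.\<close>
  define a where "a = ((c - 1) / 2) *\<^sub>R z"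
  have seg: "x + t *\<^sub>R z \<in> S" if "x \<in> S" "x + c *\<^sub>R z \<in> S" "0 \<le> t" "t \<le> c" for x t
  proof -
    have "(1 - t / c) *\<^sub>R x + (t / c) *\<^sub>R (x + c *\<^sub>R z) \<in> S"
      using that c by (intro convexD[OF S]) auto
    moreover have "(1 - t / c) *\<^sub>R x + (t / c) *\<^sub>R (x + c *\<^sub>R z) = x + t *\<^sub>R z"
      using c by (simp add: algebra_simps)
    ultimately show ?thesis by simp
  qed
  have "a + x \<in> S \<and> a + x + z \<in> S" if "x \<in> S" "x + c *\<^sub>R z \<in> S" for x
  proof -
    have "a + x = x + ((c - 1) / 2) *\<^sub>R z" "a + x + z = x + ((c - 1) / 2 + 1) *\<^sub>R z"
      by (simp_all only: a_def scaleR_left_distrib scaleR_one add_ac)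
    then show ?thesis
      using seg[OF that, of "(c - 1) / 2"] seg[OF that, of "(c - 1) / 2 + 1"] c
      by (simp add: field_simps)
  qed
  then have "(\<integral>\<^sup>+x. indicator S x * indicator S (x + c *\<^sub>R z) \<partial>lborel)
    \<le> (\<integral>\<^sup>+x. indicator S (a + x) * indicator S (a + x + z) \<partial>lborel :: ennreal)"
    by (intro nn_integral_mono) (auto simp: indicator_def)
  also have "\<dots> = (\<integral>\<^sup>+x. indicator S x * indicator S (x + z) \<partial>lborel)"
    by (rule nn_integral_lborel_translate) measurable
  finally show ?thesis .
qed

text \<open>The product Lebesgue measure of the pairs in \<open>S \<times> S\<close> at distance at
  most \<open>c\<close>, as an iterated integral. For the unit ball, dividing by the squared volume
  gives the probability \<open>F(c)\<close>.\<close>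

definition near_pairs :: "'a::euclidean_space set \<Rightarrow> real \<Rightarrow> ennreal" where
  "near_pairs S c = (\<integral>\<^sup>+x. emeasure lborel (S \<inter> cball x c) * indicator S x \<partial>lborel)"

text \<open>Substituting \<open>y = x + z\<close> and exchanging the integrals (Tonelli) exposes the
  overlap of \<open>S\<close> with its translate, the quantity that convexity controls.\<close>

lemma near_pairs_eq:
  fixes S :: "'a::euclidean_space set"
  assumes [measurable]: "S \<in> sets borel"
  shows "near_pairs S c = (\<integral>\<^sup>+z. indicator (cball 0 c) z *
    (\<integral>\<^sup>+x. indicator S x * indicator S (x + z) \<partial>lborel) \<partial>lborel)"
proof -
  have "emeasure lborel (S \<inter> cball x c) * indicator S x =
      (\<integral>\<^sup>+z. indicator (cball 0 c) z * (indicator S x * indicator S (x + z)) \<partial>lborel)" for x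
  proof -
    have "emeasure lborel (S \<inter> cball x c) = (\<integral>\<^sup>+y. indicator (S \<inter> cball x c) y \<partial>lborel)"
      by simp
    also have "\<dots> = (\<integral>\<^sup>+z. indicator (S \<inter> cball x c) (x + z) \<partial>lborel)"
      by (rule nn_integral_lborel_translate[symmetric]) measurable
    also have "\<dots> * indicator S x = (\<integral>\<^sup>+z. indicator (S \<inter> cball x c) (x + z) * indicator S x \<partial>lborel)"
      by (rule nn_integral_multc[symmetric]) measurable
    also have "\<dots> = (\<integral>\<^sup>+z. indicator (cball 0 c) z * (indicator S x * indicator S (x + z)) \<partial>lborel)"
      by (intro nn_integral_cong) (auto simp: indicator_def dist_norm)
    finally show ?thesis .
  qed
  then have "near_pairs S c = (\<integral>\<^sup>+x. \<integral>\<^sup>+z. indicator (cball 0 c) z *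
      (indicator S x * indicator S (x + z)) \<partial>lborel \<partial>lborel)"
    by (simp add: near_pairs_def)
  also have "\<dots> = (\<integral>\<^sup>+z. \<integral>\<^sup>+x. indicator (cball 0 c) z *
      (indicator S x * indicator S (x + z)) \<partial>lborel \<partial>lborel)"
    by (rule lborel_pair.Fubini') measurable
  also have "\<dots> = (\<integral>\<^sup>+z. indicator (cball 0 c) z *
      (\<integral>\<^sup>+x. indicator S x * indicator S (x + z) \<partial>lborel) \<partial>lborel)"
    by (intro nn_integral_cong nn_integral_cmult) measurable
  finally show ?thesis .
qed

lemma near_pairs_mono: "c \<le> d \<Longrightarrow> S \<in> sets borel \<Longrightarrow> near_pairs S c \<le> near_pairs S d"
  unfolding near_pairs_def by (intro nn_integral_mono mult_right_mono emeasure_mono) auto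

text \<open>Rescaling \<open>z\<close> by \<open>c\<close> turns the ball of radius \<open>c\<close>
  into the unit ball at the price of the Jacobian \<open>c ^ DIM('a)\<close>; the overlaps at
  \<open>c *\<^sub>R z\<close> and at \<open>z\<close> are then compared pointwise.\<close>

lemma near_pairs_convex_le:
  fixes S :: "'a::euclidean_space set"
  assumes "convex S" and [measurable]: "S \<in> sets borel" and c: "1 \<le> c"
  shows "near_pairs S c \<le> ennreal (c ^ DIM('a)) * near_pairs S 1"
proof -
  have *: "indicator (cball 0 c) (c *\<^sub>R z) = (indicator (cball 0 1) z :: ennreal)" for z :: 'a
    using c by (auto simp: indicator_def)
  have "near_pairs S c = ennreal (c ^ DIM('a)) * (\<integral>\<^sup>+z. indicator (cball 0 1) z *
    (\<integral>\<^sup>+x. indicator S x * indicator S (x + c *\<^sub>R z) \<partial>lborel) \<partial>lborel)"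
    unfolding near_pairs_eq[OF assms(2)] using c
    by (subst nn_integral_lborel_scaleR[of _ c]) (simp_all add: *)
  also have "\<dots> \<le> ennreal (c ^ DIM('a)) * near_pairs S 1"
    unfolding near_pairs_eq[OF assms(2)]
    by (rule mult_left_mono[OF nn_integral_mono[OF
          mult_left_mono[OF nn_integral_convex_overlap_antimono[OF assms]]]]) auto
  finally show ?thesis .
qed

text \<open>Needed for comparisons of real values: \<open>enn2real\<close> sends
  \<open>\<infinity>\<close> to 0, so it is monotone only below a finite bound.\<close>

lemma near_pairs_finite:
  assumes S: "S \<in> sets borel" "emeasure lborel S < \<infinity>"
  shows "near_pairs S c < \<infinity>"
proof -
  have "near_pairs S c \<le> (\<integral>\<^sup>+x. emeasure lborel S * indicator S x \<partial>lborel)"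
    unfolding near_pairs_def using S by (intro nn_integral_mono mult_right_mono emeasure_mono) auto
  also have "\<dots> = emeasure lborel S * emeasure lborel S"
    using S by (simp add: nn_integral_cmult)
  also have "\<dots> < \<infinity>" using S by (simp add: ennreal_mult_less_top)
  finally show ?thesis .
qed

lemma measure_cball_vec3:
  fixes x :: "real ^ 3"
  assumes "c \<ge> 0"
  shows "measure lborel (cball x c) = 4 / 3 * pi * c ^ 3"
  using content_cball[of c x] assms by (simp add: unit_ball_vol_3)

text \<open>This is \<open>\<bar>p - q\<bar> = p + q - 2 * min p q\<close> for two densities of
  total mass 1. Their minimum lives on the intersection of the balls, where it is the smaller of the
  two heights, \<open>?k\<close>.\<close>

lemma L1_loss_pred_density:
  assumes c: "c > 0"
  shows "L1_loss \<theta> (pred_density c x) =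
    2 - 2 * (3 / (4 * pi) * min 1 (1 / c ^ 3)) * measure lborel (cball \<theta> 1 \<inter> cball x c)"
proof -
  let ?k = "3 / (4 * pi) * min 1 (1 / c ^ 3)"
  have int: "integrable lborel (indicator (cball z r) :: real ^ 3 \<Rightarrow> real)" for z r
    by (intro integrable_real_indicator emeasure_lborel_cball_finite) auto
  have int2: "integrable lborel (indicator (cball \<theta> 1 \<inter> cball x c) :: real ^ 3 \<Rightarrow> real)"
    by (intro integrable_real_indicator le_less_trans[OF emeasure_mono emeasure_lborel_cball_finite])
       auto
  have "\<bar>true_density \<theta> y - pred_density c x y\<bar> =
      3 / (4 * pi) * indicator (cball \<theta> 1) y + 3 / (4 * c ^ 3 * pi) * indicator (cball x c) y
      - 2 * ?k * indicator (cball \<theta> 1 \<inter> cball x c) y" for y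
  proof -
    define d where "d = c ^ 3"
    have "d > 0" using c by (simp add: d_def)
    then show ?thesis
      unfolding true_density_def pred_density_def d_def[symmetric]
      by (auto simp: indicator_def min_def abs_if field_simps)
  qed
  then have "L1_loss \<theta> (pred_density c x) =
      (\<integral>y. 3 / (4 * pi) * indicator (cball \<theta> 1) y + 3 / (4 * c ^ 3 * pi) * indicator (cball x c) y
      - 2 * ?k * indicator (cball \<theta> 1 \<inter> cball x c) y \<partial>lborel)"
    by (simp add: L1_loss_def)
  also have "\<dots> = 3 / (4 * pi) * measure lborel (cball \<theta> 1)
      + 3 / (4 * c ^ 3 * pi) * measure lborel (cball x c)
      - 2 * ?k * measure lborel (cball \<theta> 1 \<inter> cball x c)"
    using int int2 by simp
  also have "\<dots> = 2 - 2 * ?k * measure lborel (cball \<theta> 1 \<inter> cball x c)"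
    using c by (simp add: measure_cball_vec3)
  finally show ?thesis .
qed

text \<open>The constant is \<open>2 * (3 / (4 * pi))\<^sup>2\<close>: one factor is the height of
  the true density, the other the reciprocal volume that normalises the law of
  \<open>X\<close>.\<close>

lemma risk_pred_density:
  assumes M: "prob_space M" and law: "has_law M X (uniform_ball \<theta> 1)" and c: "c > 0"
  shows "risk M X \<theta> (pred_density c) =
    2 - 9 / (8 * pi\<^sup>2) * (min 1 (1 / c ^ 3) * enn2real (near_pairs (cball \<theta> 1) c))"
proof -
  interpret prob_space M by (rule M)
  let ?B = "cball \<theta> 1" and ?k = "3 / (4 * pi) * min 1 (1 / c ^ 3)"
  let ?W = "\<lambda>x. measure lborel (?B \<inter> cball x c)"
  have [measurable]: "X \<in> borel_measurable M"
    and distr: "distr M borel X = uniform_measure lborel ?B"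
    using law by (auto simp: has_law_def uniform_ball_def)
  have vol: "emeasure lborel ?B = ennreal (4 / 3 * pi)"
    using measure_cball_vec3[of 1 \<theta>] emeasure_lborel_cball_finite[of \<theta> 1]
    by (simp add: emeasure_eq_ennreal_measure less_top)
  have fin: "emeasure lborel (?B \<inter> cball x c) < \<infinity>" for x
    by (rule le_less_trans[OF emeasure_mono emeasure_lborel_cball_finite[of \<theta> 1]]) auto
  \<comment> \<open>Measurability of \<open>?W\<close> in the centre: written with
    \<open>dist x y\<close>, the integrand is jointly measurable in \<open>x\<close> and
    \<open>y\<close>, so its integral over \<open>y\<close> is measurable in
    \<open>x\<close>.\<close>
  have "(\<lambda>x. \<integral>y. indicator ?B y * indicator {..c} (dist x y) \<partial>lborel :: real)
      \<in> borel_measurable borel"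
    by (rule lborel.borel_measurable_lebesgue_integral) measurable
  also have "(\<lambda>x. \<integral>y. indicator ?B y * indicator {..c} (dist x y) \<partial>lborel) = ?W"
  proof
    fix x
    have "(\<integral>y. indicator ?B y * indicator {..c} (dist x y) \<partial>lborel :: real) =
        (\<integral>y. indicator (?B \<inter> cball x c) y \<partial>lborel)"
      by (intro Bochner_Integration.integral_cong) (auto simp: indicator_def)
    then show "(\<integral>y. indicator ?B y * indicator {..c} (dist x y) \<partial>lborel) = ?W x" by simp
  qed
  finally have W[measurable]: "?W \<in> borel_measurable borel" .
  have "?W x \<le> measure lborel ?B" for x
    using emeasure_lborel_cball_finite[of \<theta> 1]
    by (intro measure_mono_fmeasurable) (auto simp: fmeasurable_def)
  then have int: "integrable M (\<lambda>\<omega>. ?W (X \<omega>))"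
    by (intro integrable_const_bound[where B = "measure lborel ?B"]) auto
  have "risk M X \<theta> (pred_density c) = 2 - 2 * ?k * (\<integral>\<omega>. ?W (X \<omega>) \<partial>M)"
    unfolding risk_def L1_loss_pred_density[OF c] using int by (simp add: prob_space)
  also have "(\<integral>\<omega>. ?W (X \<omega>) \<partial>M) = (\<integral>x. ?W x \<partial>uniform_measure lborel ?B)"
    unfolding distr[symmetric] by (simp add: integral_distr)
  also have "\<dots> = enn2real (\<integral>\<^sup>+x. ennreal (?W x) \<partial>uniform_measure lborel ?B)"
    by (rule integral_eq_nn_integral) auto
  also have "(\<integral>\<^sup>+x. ennreal (?W x) \<partial>uniform_measure lborel ?B) =
      (\<integral>\<^sup>+x. ennreal (?W x) * indicator ?B x \<partial>lborel) / emeasure lborel ?B"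
    by (rule nn_integral_uniform_measure) auto
  also have "(\<integral>\<^sup>+x. ennreal (?W x) * indicator ?B x \<partial>lborel) = near_pairs ?B c"
    unfolding near_pairs_def using fin by (simp add: emeasure_eq_ennreal_measure less_top)
  also have "enn2real (near_pairs ?B c / emeasure lborel ?B) =
      enn2real (near_pairs ?B c) / (4 / 3 * pi)"
    unfolding vol divide_ennreal_def by (simp add: enn2real_mult inverse_ennreal field_simps)
  finally show ?thesis by (simp add: field_simps power2_eq_square)
qed

theorem theorem6:
  fixes \<theta> :: "real ^ 3" and M :: "'a measure" and X Y :: "'a \<Rightarrow> real ^ 3"
  assumes "prob_space M"
    and "has_law M X (uniform_ball \<theta> 1)"
    and "has_law M Y (uniform_ball \<theta> 1)"
    and "prob_space.indep_var M borel X borel Y"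
  shows "\<forall>c>0. risk M X \<theta> (pred_density 1) \<le> risk M X \<theta> (pred_density c)"
proof (intro allI impI)
  fix c :: real
  assume c: "c > 0"
  let ?B = "cball \<theta> 1"
  let ?F = "\<lambda>c. enn2real (near_pairs ?B c)"
  have fin: "near_pairs ?B r < \<infinity>" for r
    using emeasure_lborel_cball_finite[of \<theta> 1] by (intro near_pairs_finite) auto
  \<comment> \<open>The risk is a decreasing affine function of the left side, and at
    \<open>c = 1\<close> the left side is \<open>?F 1\<close>.\<close>
  have "min 1 (1 / c ^ 3) * ?F c \<le> ?F 1"
  proof (cases "c \<le> 1")
    case True
    have "?F c \<le> ?F 1"
      using fin[of 1] True by (intro enn2real_mono near_pairs_mono) auto
    moreover have "min 1 (1 / c ^ 3) * ?F c \<le> 1 * ?F c"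
      by (intro mult_right_mono) auto
    ultimately show ?thesis by linarith
  next
    case False
    \<comment> \<open>In dimension 3 the Jacobian bound is \<open>c ^ 3\<close>, which exactly
      cancels the height factor \<open>1 / c ^ 3\<close>.\<close>
    have "?F c \<le> enn2real (ennreal (c ^ 3) * near_pairs ?B 1)"
      using near_pairs_convex_le[of ?B c] fin[of 1] False
      by (intro enn2real_mono) (auto simp: ennreal_mult_less_top)
    also have "\<dots> = c ^ 3 * ?F 1"
      using c by (simp add: enn2real_mult)
    finally have "1 / c ^ 3 * ?F c \<le> ?F 1"
      using c by (simp add: field_simps)
    moreover have "min 1 (1 / c ^ 3) * ?F c \<le> 1 / c ^ 3 * ?F c"
      by (intro mult_right_mono) auto
    ultimately show ?thesis by linarith
  qed
  then have "9 / (8 * pi\<^sup>2) * (min 1 (1 / c ^ 3) * ?F c) \<le> 9 / (8 * pi\<^sup>2) * ?F 1"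
    by (intro mult_left_mono) auto
  then show "risk M X \<theta> (pred_density 1) \<le> risk M X \<theta> (pred_density c)"
    by (simp add: risk_pred_density[OF assms(1,2)] c)
qed

end
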